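(* Let $\mathbb{K}\in\{\mathbb{R},\mathbb{C}\}$, let $M,N,D\ge 1$ and $\Delta D\ge 0$ be integers, and let $\mathbf{a}=(\mathbf{a}_{\mathbf{j}})_{\mathbf{j}\in\{1,\dots,N+1\}^D}$, $\mathbf{a}_{\mathbf{j}}\in\mathbb{K}^{M}$, be the coefficient tensor of a degree-$D$ polynomial system $\mathbf{a}\Pi$ of $M$ equations in $N$ unknowns, with equivalent monomials collected. Let $(\mathbf{Q}_{\mathrm u},\mathbf{Q}^{\mathrm v},\mathbf{r})$ be a Qr factorization of $\mathbf{a}$ of incremental degree $\Delta D$, so that in particular the coefficients transform via the forward unitary factor $\mathbf{Q}_{\mathrm u}$ as $$\mathbf{r}_{\mathbf{k}}=\sum_{\substack{\mathbf{i}\in\{1,\dots,N+1\}^{\Delta D},\ \mathbf{j}\in\{1,\dots,N+1\}^{D}\\ \operatorname{sort}(\mathbf{i},\mathbf{j})=\mathbf{k}}}(\mathbf{Q}_{\mathrm u}^{\mathbf{i}})^*\,\mathbf{a}_{\mathbf{j}}\qquad\text{for all }\mathbf{k}\in\{1,\dots,N+1\}^{D+\Delta D}.$$ Then the zero set of the triangular system $\mathbf{r}\Pi$ contains the zero set of the given system $\mathbf{a}\Pi$: for every $\mathbf{x}\in\mathbb{K}^N$, if $\sum_{\mathbf{j}}\mathbf{a}_{\mathbf{j}}\Pi^{\mathbf{j}}(\mathbf{x},1)=\mathbf{0}$, then $\sum_{\mathbf{k}}\mathbf{r}_{\mathbf{k}}\Pi^{\mathbf{k}}(\mathbf{x},1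)=\mathbf{0}$.
   Context: Multi-indices. For an integer $L\ge 0$, a multi-index of length $L$ is an element of $\{1,\dots,N+1\}^L$ (for $L=0$ there is exactly one, the empty one). Concatenation of multi-indices is written $(\mathbf{i},\mathbf{j})$, and $\operatorname{sort}$ rearranges the entries of a multi-index in ascending (nondecreasing) order. $\mathbf{0}$ used as a multi-index denotes the constant multi-index $(N+1,\dots,N+1)$ of the length required by context. Monomial values. For $\mathbf{x}\in\mathbb{K}^N$ put $x^{(n)}=x_n$ for $1\le n\le N$ and $x^{(N+1)}=1$. For a multi-index $\mathbf{j}=(j_1,\dots,j_L)$ define $\Pi^{\mathbf{j}}(\mathbf{x},1)=x^{(j_1)}x^{(j_2)}\cdots x^{(j_L)}$ (equal to $1$ if $L=0$). Polynomial systems. A family $\mathbf{a}=(\mathbf{a}_{\mathbf{j}})_{\mathbf{j}\in\{1,\dots,N+1\}^L}$ of vectors in $\mathbb{K}^M$ defines the polynomial system $\mathbf{a}\Pi$: $\sum_{\mathbf{j}}\mathbf{a}_{\mathbf{j}}\Pi^{\mathbf{j}}(\mathbf{x},1)=\mathbf{0}$, of $M$ equations in the unknown $\mathbf{x}\in\mathbb{K}^N$; its zero set is the set of all solutions $\mathbf{x}\in\mathbb{K}^N$. Equivalent monomials are collected in $\mathbf{a}$ if $\mathbf{a}_{\mathbf{j}}=\sum_{\mathbf{i}:\ \operatorname{sort}(\mathbf{i})=\mathbf{j}}\mathbf{a}_{\mathbf{i}}$ for all $\mathbf{j}$ (equivalently, $\mathbf{a}_{\mathbf{j}}=\mathbf{0}$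 whenever $\mathbf{j}$ is not in ascending order). Triangularity. A family $\mathbf{r}=(\mathbf{r}_{\mathbf{k}})_{\mathbf{k}\in\{1,\dots,N+1\}^L}$ of vectors in $\mathbb{K}^M$, $L\ge 1$, is upper-triangular if for all $m\in\{1,\dots,M\}$ and all $\mathbf{k}$, $(\mathbf{r}_{\mathbf{k}})_m=\sum_{(n,\mathbf{j}):\ \operatorname{sort}(n,\mathbf{j})=(m,\mathbf{k})}(\mathbf{r}_{\mathbf{j}})_n$, where $n$ ranges over $\{1,\dots,M\}$, $\mathbf{j}$ over $\{1,\dots,N+1\}^L$, and $\operatorname{sort}$ is applied to tuples of positive integers (equivalently, $(\mathbf{r}_{\mathbf{k}})_m=0$ unless $m\le k_1\le k_2\le\dots\le k_L$). Qr factorization. Let $\mathbf{a}$ be of degree $D$ (indexed by $\{1,\dots,N+1\}^D$) with equivalent monomials collected. A Qr factorization of $\mathbf{a}$ of incremental degree $\Delta D$ consists of families of $M\times M$ matrices over $\mathbb{K}$, $\mathbf{Q}_{\mathrm u}=(\mathbf{Q}_{\mathrm u}^{\mathbf{i}})$ (forward unitary factor) and $\mathbf{Q}^{\mathrm v}=(\mathbf{Q}^{\mathrm v}_{\mathbf{h}})$ (backward unitary factor), both indexed by $\{1,\dots,N+1\}^{\Delta D}$, and an upper-triangular family $\mathbf{r}=(\mathbf{r}_{\mathbf{k}})$ of vectors in $\mathbb{K}^M$ indexed by $\{1,\dots,N+1\}^{D+\Delta D}$ (triangular factor), such that, with $^*$ denoting the conjugate transpose and $\mathbf{I}$ the $M\times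 M$ identity matrix: (1) $\mathbf{r}_{\mathbf{k}}=\sum_{\operatorname{sort}(\mathbf{i},\mathbf{j})=\mathbf{k}}(\mathbf{Q}_{\mathrm u}^{\mathbf{i}})^*\mathbf{a}_{\mathbf{j}}$ for all $\mathbf{k}\in\{1,\dots,N+1\}^{D+\Delta D}$; (2) $\mathbf{a}_{\mathbf{j}}=\sum_{\operatorname{sort}(\mathbf{h},\mathbf{k})=(\mathbf{j},\mathbf{0})}\mathbf{Q}^{\mathrm v}_{\mathbf{h}}\mathbf{r}_{\mathbf{k}}$ for all $\mathbf{j}\in\{1,\dots,N+1\}^{D}$, where here $\mathbf{0}$ has length $2\Delta D$; (3) (first unitary identity) $(\mathbf{Q}_{\mathrm u}^{\mathbf{0}})^*\mathbf{Q}_{\mathrm u}^{\mathbf{0}}=\mathbf{I}$; (4) (second unitary identity) for all $\mathbf{k}\in\{1,\dots,N+1\}^{2\Delta D}$, $\sum_{\operatorname{sort}(\mathbf{i},\mathbf{j})=\mathbf{k}}\mathbf{Q}^{\mathrm v}_{\mathbf{i}}(\mathbf{Q}_{\mathrm u}^{\mathbf{j}})^*$ equals $\mathbf{I}$ if $\mathbf{k}=\mathbf{0}$ and the zero matrix otherwise. *)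

theory Defs
  imports "Jordan_Normal_Form.Schur_Decomposition"
begin

(* Multi-indices have entries in {1..N+1}, while vectors and matrices are indexed
   from 0, so component number m of a vector v is v $ (m - 1). *)

definition multi_indices :: "nat \<Rightarrow> nat \<Rightarrow> nat list set" where
  "multi_indices N L = {j. length j = L \<and> set j \<subseteq> {1..N + 1}}"

definition const_index :: "nat \<Rightarrow> nat \<Rightarrow> nat list" where
  "const_index N L = replicate L (N + 1)"

(* The extra unknown x^(N+1) is the constant 1. *)
definition ext_component :: "nat \<Rightarrow> 'a :: field vec \<Rightarrow> nat \<Rightarrow> 'a" where
  "ext_component N x n = (if n = N + 1 then 1 else x $ (n - 1))"

definition monomial_value :: "nat \<Rightarrow> 'a :: field vec \<Rightarrow> nat list \<Rightarrow> 'a" where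
  "monomial_value N x j = (\<Prod>n\<leftarrow>j. ext_component N x n)"

(* A family indexed by {1..N+1}^L is a total function on lists, of which only the
   values on multi_indices N L are relevant. *)
definition coeff_family :: "nat \<Rightarrow> nat \<Rightarrow> nat \<Rightarrow> (nat list \<Rightarrow> 'a vec) \<Rightarrow> bool" where
  "coeff_family M N L a \<longleftrightarrow> (\<forall>j \<in> multi_indices N L. a j \<in> carrier_vec M)"

definition matrix_family :: "nat \<Rightarrow> nat \<Rightarrow> nat \<Rightarrow> (nat list \<Rightarrow> 'a mat) \<Rightarrow> bool" where
  "matrix_family M N L Q \<longleftrightarrow> (\<forall>i \<in> multi_indices N L. Q i \<in> carrier_mat M M)"

definition zero_set :: "nat \<Rightarrow> nat \<Rightarrow> nat \<Rightarrow> (nat list \<Rightarrow> 'a :: field vec) \<Rightarrow> 'a vec set" where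
  "zero_set M N L a =
     {x \<in> carrier_vec N.
        finsum_vec TYPE('a) M (\<lambda>j. monomial_value N x j \<cdot>\<^sub>v a j) (multi_indices N L) = 0\<^sub>v M}"

definition monomials_collected ::
    "nat \<Rightarrow> nat \<Rightarrow> nat \<Rightarrow> (nat list \<Rightarrow> 'a :: field vec) \<Rightarrow> bool" where
  "monomials_collected M N L a \<longleftrightarrow>
     (\<forall>j \<in> multi_indices N L.
        a j = finsum_vec TYPE('a) M a {i \<in> multi_indices N L. sort i = j})"

(* The equation number m is sorted together with the entries of the multi-index. *)
definition upper_triangular_family ::
    "nat \<Rightarrow> nat \<Rightarrow> nat \<Rightarrow> (nat list \<Rightarrow> 'a :: field vec) \<Rightarrow> bool" where
  "upper_triangular_family M N L r \<longleftrightarrow>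
     (\<forall>m \<in> {1..M}. \<forall>k \<in> multi_indices N L.
        r k $ (m - 1) =
          (\<Sum>(n, j) \<in> {(n, j) \<in> {1..M} \<times> multi_indices N L. sort (n # j) = m # k}.
             r j $ (n - 1)))"

definition qr_factorization ::
    "nat \<Rightarrow> nat \<Rightarrow> nat \<Rightarrow> nat \<Rightarrow> (nat list \<Rightarrow> 'a :: conjugatable_field vec) \<Rightarrow>
     (nat list \<Rightarrow> 'a mat) \<Rightarrow> (nat list \<Rightarrow> 'a mat) \<Rightarrow> (nat list \<Rightarrow> 'a vec) \<Rightarrow> bool" where
  "qr_factorization M N D \<Delta>D a Qu Qv r \<longleftrightarrow>
     matrix_family M N \<Delta>D Qu \<and>
     matrix_family M N \<Delta>D Qv \<and>
     coeff_family M N (D + \<Delta>D) r \<and>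
     upper_triangular_family M N (D + \<Delta>D) r \<and>
     (\<forall>k \<in> multi_indices N (D + \<Delta>D).
        r k = finsum_vec TYPE('a) M (\<lambda>(i, j). mat_adjoint (Qu i) *\<^sub>v a j)
                {(i, j) \<in> multi_indices N \<Delta>D \<times> multi_indices N D. sort (i @ j) = k}) \<and>
     (\<forall>j \<in> multi_indices N D.
        a j = finsum_vec TYPE('a) M (\<lambda>(h, k). Qv h *\<^sub>v r k)
                {(h, k) \<in> multi_indices N \<Delta>D \<times> multi_indices N (D + \<Delta>D).
                   sort (h @ k) = j @ const_index N (2 * \<Delta>D)}) \<and>
     mat_adjoint (Qu (const_index N \<Delta>D)) * Qu (const_index N \<Delta>D) = 1\<^sub>m M \<and>
     (\<forall>k \<in> multi_indices N (2 * \<Delta>D).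
        finsum (module_mat TYPE('a) M M) (\<lambda>(i, j). Qv i * mat_adjoint (Qu j))
          {(i, j) \<in> multi_indices N \<Delta>D \<times> multi_indices N \<Delta>D. sort (i @ j) = k} =
        (if k = const_index N (2 * \<Delta>D) then 1\<^sub>m M else 0\<^sub>m M M))"

end

theory Submission
  imports Defs
begin

text \<open>Monomial values are multiplicative under concatenation and invariant under sorting, so
  evaluating the forward transformation at \<open>\<^bold>x\<close> yields
  \<open>\<Sum>\<^sub>k r\<^sub>k \<Pi>\<^sup>k = (\<Sum>\<^sub>i \<Pi>\<^sup>i (Q\<^sup>i)\<^sup>*) (\<Sum>\<^sub>j a\<^sub>j \<Pi>\<^sup>j)\<close>:
  the transformed system is a matrix multiple of the given one at every point.\<close>

lemma finite_multi_indices [simp]: "finite (multi_indices N L)"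
proof -
  have "multi_indices N L = {j. set j \<subseteq> {1..N + 1} \<and> length j = L}"
    by (auto simp: multi_indices_def)
  then show ?thesis by (simp add: finite_lists_length_eq)
qed

lemma sort_append_in_multi_indices:
  assumes "i \<in> multi_indices N K" "j \<in> multi_indices N L"
  shows "sort (i @ j) \<in> multi_indices N (L + K)"
  using assms by (auto simp: multi_indices_def)

text \<open>Multiplication in a field is commutative, so the product depends only on the multiset of
  entries, which sorting preserves.\<close>

lemma monomial_value_sort: "monomial_value N x (sort j) = monomial_value N x j"
  unfolding monomial_value_def by (metis mset_map mset_sort prod_mset_prod_list)

lemma monomial_value_append:
  "monomial_value N x (i @ j) = monomial_value N x i * monomial_value N x j"
  by (simp add: monomial_value_def)

text \<open>With the adjoints abstracted to matrices \<open>P i\<close>, the argument is pure linear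
  algebra over a field: each component of the new system at \<open>x\<close> is a linear combination
  of the components of the old one.\<close>

lemma zero_set_subset_of_transform:
  fixes a r :: "nat list \<Rightarrow> 'a :: field vec" and P :: "nat list \<Rightarrow> 'a mat"
  assumes a: "coeff_family M N D a" and P: "matrix_family M N K P"
    and r: "\<And>k. k \<in> multi_indices N (D + K) \<Longrightarrow>
      r k = finsum_vec TYPE('a) M (\<lambda>(i, j). P i *\<^sub>v a j)
              {(i, j) \<in> multi_indices N K \<times> multi_indices N D. sort (i @ j) = k}"
  shows "zero_set M N D a \<subseteq> zero_set M N (D + K) r"
proof
  fix x assume x: "x \<in> zero_set M N D a"
  let ?I = "multi_indices N K" and ?J = "multi_indices N D" and ?K = "multi_indices N (D + K)"
  let ?\<Pi> = "monomial_value N x"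
  let ?S = "\<lambda>k. {(i, j) \<in> ?I \<times> ?J. sort (i @ j) = k}"
  have aj: "a j \<in> carrier_vec M" if "j \<in> ?J" for j
    using a that by (auto simp: coeff_family_def)
  have Pi: "P i \<in> carrier_mat M M" if "i \<in> ?I" for i
    using P that by (auto simp: matrix_family_def)
  have fS: "finite (?S k)" for k
    by (rule finite_subset[of _ "?I \<times> ?J"]) auto
  have Paj: "(\<lambda>(i, j). P i *\<^sub>v a j) \<in> ?S k \<rightarrow> carrier_vec M" for k
    using aj Pi by (auto intro: mult_mat_vec_carrier)
  have rk: "r k \<in> carrier_vec M" if "k \<in> ?K" for k
    using r[OF that] finsum_vec_closed[OF Paj] by simp
  \<comment> \<open>The assumption on \<open>x\<close>, read off componentwise; these are the sums
    to be factored out at the end.\<close>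
  have a0: "(\<Sum>j\<in>?J. ?\<Pi> j * a j $ l) = 0" if l: "l < M" for l
  proof -
    have "(\<Sum>j\<in>?J. ?\<Pi> j * a j $ l) = (\<Sum>j\<in>?J. (?\<Pi> j \<cdot>\<^sub>v a j) $ l)"
      using l by (intro sum.cong) (auto dest: aj[THEN carrier_vecD])
    also have "\<dots> = finsum_vec TYPE('a) M (\<lambda>j. ?\<Pi> j \<cdot>\<^sub>v a j) ?J $ l"
      using aj l by (subst index_finsum_vec) auto
    finally show ?thesis using x l by (simp add: zero_set_def)
  qed
  have "finsum_vec TYPE('a) M (\<lambda>k. ?\<Pi> k \<cdot>\<^sub>v r k) ?K = 0\<^sub>v M"
  proof (rule eq_vecI)
    show "dim_vec (finsum_vec TYPE('a) M (\<lambda>k. ?\<Pi> k \<cdot>\<^sub>v r k) ?K) = dim_vec (0\<^sub>v M)"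
      using finsum_vec_closed[of "\<lambda>k. ?\<Pi> k \<cdot>\<^sub>v r k" ?K M] rk by auto
  next
    fix m assume "m < dim_vec (0\<^sub>v M :: 'a vec)"
    then have m: "m < M" by simp
    have entry: "(P i *\<^sub>v a j) $ m = (\<Sum>l<M. P i $$ (m, l) * a j $ l)"
      if "i \<in> ?I" "j \<in> ?J" for i j
      using m carrier_vecD[OF aj[OF that(2)]] carrier_matD[OF Pi[OF that(1)]]
      by (simp add: scalar_prod_def lessThan_atLeast0)
    \<comment> \<open>On \<open>?S k\<close> the weight \<open>?\<Pi> k\<close> equals
      \<open>?\<Pi> i * ?\<Pi> j\<close>, so the summand can be written without
      \<open>k\<close>.\<close>
    let ?f = "\<lambda>(i, j). ?\<Pi> i * ?\<Pi> j * (P i *\<^sub>v a j) $ m"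
    have "finsum_vec TYPE('a) M (\<lambda>k. ?\<Pi> k \<cdot>\<^sub>v r k) ?K $ m = (\<Sum>k\<in>?K. ?\<Pi> k * r k $ m)"
      using rk m by (subst index_finsum_vec) (auto dest: rk[THEN carrier_vecD] intro!: sum.cong)
    also have "\<dots> = (\<Sum>k\<in>?K. \<Sum>p\<in>?S k. ?f p)"
    proof (rule sum.cong[OF refl])
      fix k assume k: "k \<in> ?K"
      have "r k $ m = (\<Sum>p\<in>?S k. (\<lambda>(i, j). P i *\<^sub>v a j) p $ m)"
        unfolding r[OF k] using fS m Paj by (rule index_finsum_vec)
      then show "?\<Pi> k * r k $ m = (\<Sum>p\<in>?S k. ?f p)"
        by (auto simp: sum_distrib_left monomial_value_sort monomial_value_append intro!: sum.cong)
    qed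
    \<comment> \<open>Only the form of the index set changes, to fit \<open>sum.group\<close>. Since
      sorted concatenations lie in \<open>?K\<close>, the fibres over \<open>?K\<close> exhaust
      \<open>?I \<times> ?J\<close>, and the double sum then merges into one.\<close>
    also have "\<dots> = (\<Sum>k\<in>?K. \<Sum>p | p \<in> ?I \<times> ?J \<and> (\<lambda>(i, j). sort (i @ j)) p = k. ?f p)"
      by (intro sum.cong) auto
    also have "\<dots> = (\<Sum>p\<in>?I \<times> ?J. ?f p)"
      by (rule sum.group) (auto intro: sort_append_in_multi_indices)
    also have "\<dots> = (\<Sum>i\<in>?I. \<Sum>j\<in>?J. ?\<Pi> i * ?\<Pi> j * (\<Sum>l<M. P i $$ (m, l) * a j $ l))"
      unfolding sum.cartesian_product by (intro sum.cong refl) (auto simp: entry)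
    \<comment> \<open>Exchanging the sums over \<open>j\<close> and \<open>l\<close> isolates
      component \<open>l\<close> of the given system at \<open>x\<close>, which vanishes by
      \<open>a0\<close>.\<close>
    also have "\<dots> = (\<Sum>i\<in>?I. \<Sum>l<M. ?\<Pi> i * P i $$ (m, l) * (\<Sum>j\<in>?J. ?\<Pi> j * a j $ l))"
      unfolding sum_distrib_left by (subst sum.swap[of _ ?J]) (simp add: ac_simps)
    also have "\<dots> = 0" by (simp add: a0)
    finally show "finsum_vec TYPE('a) M (\<lambda>k. ?\<Pi> k \<cdot>\<^sub>v r k) ?K $ m = 0\<^sub>v M $ m"
      using m by simp
  qed
  then show "x \<in> zero_set M N (D + K) r"
    using x by (simp add: zero_set_def)
qed

lemma mat_adjoint_carrier: "A \<in> carrier_mat n m \<Longrightarrow> mat_adjoint A \<in> carrier_mat m n"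
  by (auto simp: mat_adjoint_def)

text \<open>The forward transformation of the factorization is the preceding situation with
  \<open>P i\<close> the adjoint of \<open>Qu i\<close>.\<close>

lemma zero_set_subset_qr_factorization:
  fixes a :: "nat list \<Rightarrow> 'a :: conjugatable_field vec"
  assumes "coeff_family M N D a" and "qr_factorization M N D \<Delta>D a Qu Qv r"
  shows "zero_set M N D a \<subseteq> zero_set M N (D + \<Delta>D) r"
  using assms
  by (intro zero_set_subset_of_transform[where P = "\<lambda>i. mat_adjoint (Qu i)"])
    (auto simp: qr_factorization_def matrix_family_def intro: mat_adjoint_carrier)

theorem theorem1:
  fixes M N D \<Delta>D :: nat
  assumes "M \<ge> 1" and "N \<ge> 1" and "D \<ge> 1"
  shows "(\<forall>(a :: nat list \<Rightarrow> real vec) Qu Qv r.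
            coeff_family M N D a \<longrightarrow> monomials_collected M N D a \<longrightarrow>
            qr_factorization M N D \<Delta>D a Qu Qv r \<longrightarrow>
            zero_set M N D a \<subseteq> zero_set M N (D + \<Delta>D) r) \<and>
         (\<forall>(a :: nat list \<Rightarrow> complex vec) Qu Qv r.
            coeff_family M N D a \<longrightarrow> monomials_collected M N D a \<longrightarrow>
            qr_factorization M N D \<Delta>D a Qu Qv r \<longrightarrow>
            zero_set M N D a \<subseteq> zero_set M N (D + \<Delta>D) r)"
  \<comment> \<open>Both \<open>real\<close> and \<open>complex\<close> are instances of
    \<open>conjugatable_field\<close>, so one lemma settles both conjuncts.\<close>
  by (intro conjI allI impI zero_set_subset_qr_factorization)

end
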